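(* Let $a,b,c\in\mathbb{R}$ with $a\neq 0$, let $g:\mathbb{R}\to\mathbb{R}$, $g(x)=ax^2+bx+c$, let $\delta:=b^2-4ac-2b-7$, and assume $\delta\ge 0$. Let $$\delta_{nh}:=\frac{\left(\left(460+60\sqrt{201}\right)^{\frac{2}{3}}-2\left(460+60\sqrt{201}\right)^{\frac{1}{3}}-80\right)^{2}}{36\left(460+60\sqrt{201}\right)^{\frac{2}{3}}}\approx 0.074.$$ The stability of the 3-cycles of the map $x_{t+1}=g(x_t)$ is characterized as follows. (i) If $\delta\in(\delta_{nh},\infty)$, then both $\mathcal{C}_{\langle\delta\rangle}$ and $\mathcal{C}_{\langle-\delta\rangle}$ are unstable. (ii) If $\delta\in(0,\delta_{nh}]$, then $\mathcal{C}_{\langle\delta\rangle}$ is asymptotically stable, while $\mathcal{C}_{\langle-\delta\rangle}$ is unstable. (iii) If $\delta=0$, then $\mathcal{C}_{\langle 0\rangle}$ is unstable.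
   Context: A 3-cycle of the map $x_{t+1}=g(x_t)$ is the class, modulo cyclic permutation, of an ordered triple $(x,y,z)$ of pairwise distinct real numbers with $g(x)=y$, $g(y)=z$, $g(z)=x$; its points are $x,y,z$. For $\beta\in\mathbb{R}$ let $Q_\beta(X)=X^3+(1-\beta)X^2-(2+\beta)X-1$. All roots of $Q_\beta$ are real, distinct and nonzero; they are denoted $q^{\langle\beta\rangle}_1<q^{\langle\beta\rangle}_2<q^{\langle\beta\rangle}_3$. For $\delta=0$ the map has a unique 3-cycle $\mathcal{C}_{\langle0\rangle}$, whose points are $\frac{-b+1}{2a}+\frac{1}{a q^{\langle0\rangle}_i}$, $i\in\{1,2,3\}$. For $\delta>0$ the map has exactly two 3-cycles: $\mathcal{C}_{\langle\delta\rangle}$, whose points are $\frac{-b+\sqrt{\delta}+1}{2a}+\frac{1}{a q^{\langle\sqrt{\delta}\rangle}_i}$, and $\mathcal{C}_{\langle-\delta\rangle}$, whose points are $\frac{-b-\sqrt{\delta}+1}{2a}+\frac{1}{a q^{\langle-\sqrt{\delta}\rangle}_i}$, $i\in\{1,2,3\}$. Write $g^{(n)}$ for the $n$-th iterate of $g$. A 3-cycle is stable if one (equivalently, any) of its points $x$ is a Lyapunov stable fixed point of $g^{(3)}$: for every $\varepsilon>0$ there is $\eta>0$ such that $|x_0-x|<\eta$ implies $|g^{(3t)}(x_0)-x|<\varepsilon$ for all $t\in\mathbb{N}$. It is unstable if it is not stable. It is asymptotically stable if it is stable and there is $\gamma>0$ such that $|x_0-x|<\gamma$ implies $\lim_{t\to\infty}g^{(3t)}(x_0)=x$.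 *)

theory Defs
  imports "HOL-Analysis.Analysis" "HOL-Computational_Algebra.Polynomial"
begin

text \<open>A 3-cycle is a class of triples modulo cyclic permutation, represented as the
  set of the three rotations of a triple.\<close>

definition three_cycle_triple :: "(real \<Rightarrow> real) \<Rightarrow> real \<times> real \<times> real \<Rightarrow> bool" where
  "three_cycle_triple g = (\<lambda>(x, y, z).
     x \<noteq> y \<and> y \<noteq> z \<and> z \<noteq> x \<and> g x = y \<and> g y = z \<and> g z = x)"

definition cyclic_class :: "real \<times> real \<times> real \<Rightarrow> (real \<times> real \<times> real) set" where
  "cyclic_class = (\<lambda>(x, y, z). {(x, y, z), (y, z, x), (z, x, y)})"

definition three_cycles :: "(real \<Rightarrow> real) \<Rightarrow> (real \<times> real \<times> real) set set" where
  "three_cycles g = cyclic_class ` {p. three_cycle_triple g p}"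

definition cycle_points :: "(real \<times> real \<times> real) set \<Rightarrow> real set" where
  "cycle_points C = (\<Union>(x, y, z)\<in>C. {x, y, z})"

definition Q_poly :: "real \<Rightarrow> real poly" where
  "Q_poly \<beta> = [:-1, -(2 + \<beta>), 1 - \<beta>, 1:]"

text \<open>For \<open>i \<in> {1, 2, 3}\<close>, \<open>q_root \<beta> i\<close> is the \<open>i\<close>-th smallest root of \<open>Q_poly \<beta>\<close>.\<close>

definition q_root :: "real \<Rightarrow> nat \<Rightarrow> real" where
  "q_root \<beta> i = sorted_list_of_set {x. poly (Q_poly \<beta>) x = 0} ! (i - 1)"

text \<open>The 3-cycle of \<open>g = (\<lambda>x. a * x\<^sup>2 + b * x + c)\<close> with parameter \<open>\<beta>\<close>, where \<open>\<beta>\<^sup>2 = \<delta>\<close>: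
  \<open>\<beta> = sqrt \<delta>\<close> gives the cycle indexed by \<open>\<delta>\<close> and \<open>\<beta> = - sqrt \<delta>\<close> the one indexed by \<open>-\<delta>\<close>.
  A 3-cycle of \<open>g\<close> is determined by its set of points, since \<open>g\<close> fixes the orientation.\<close>

definition cycle_of :: "(real \<Rightarrow> real) \<Rightarrow> real \<Rightarrow> real \<Rightarrow> real \<Rightarrow> (real \<times> real \<times> real) set" where
  "cycle_of g a b \<beta> = (THE C. C \<in> three_cycles g \<and>
     cycle_points C = (\<lambda>i. (- b + \<beta> + 1) / (2 * a) + 1 / (a * q_root \<beta> i)) ` {1, 2, 3})"

definition lyapunov_stable_point :: "(real \<Rightarrow> real) \<Rightarrow> real \<Rightarrow> bool" where
  "lyapunov_stable_point g x \<longleftrightarrow> (g ^^ 3) x = x \<and>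
     (\<forall>\<epsilon>>0. \<exists>\<eta>>0. \<forall>x0. \<bar>x0 - x\<bar> < \<eta> \<longrightarrow> (\<forall>t. \<bar>(g ^^ (3 * t)) x0 - x\<bar> < \<epsilon>))"

definition attracting_point :: "(real \<Rightarrow> real) \<Rightarrow> real \<Rightarrow> bool" where
  "attracting_point g x \<longleftrightarrow>
     (\<exists>\<gamma>>0. \<forall>x0. \<bar>x0 - x\<bar> < \<gamma> \<longrightarrow> (\<lambda>t. (g ^^ (3 * t)) x0) \<longlonglongrightarrow> x)"

definition stable_cycle :: "(real \<Rightarrow> real) \<Rightarrow> (real \<times> real \<times> real) set \<Rightarrow> bool" where
  "stable_cycle g C \<longleftrightarrow> (\<exists>x\<in>cycle_points C. lyapunov_stable_point g x)"

definition unstable_cycle :: "(real \<Rightarrow> real) \<Rightarrow> (real \<times> real \<times> real) set \<Rightarrow> bool" where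
  "unstable_cycle g C \<longleftrightarrow> \<not> stable_cycle g C"

definition asymptotically_stable_cycle ::
    "(real \<Rightarrow> real) \<Rightarrow> (real \<times> real \<times> real) set \<Rightarrow> bool" where
  "asymptotically_stable_cycle g C \<longleftrightarrow>
     (\<exists>x\<in>cycle_points C. lyapunov_stable_point g x \<and> attracting_point g x)"

definition delta_nh :: real where
  "delta_nh =
     ((460 + 60 * sqrt 201) powr (2 / 3) - 2 * (460 + 60 * sqrt 201) powr (1 / 3) - 80)\<^sup>2
     / (36 * (460 + 60 * sqrt 201) powr (2 / 3))"

end

theory Submission
  imports Defs
begin

text \<open>
  An affine change of variable conjugates \<open>g\<close> to \<open>p \<mapsto> p\<^sup>2 + (\<beta> + 1) p - 2\<close> with \<open>\<beta>\<^sup>2 = \<delta>\<close>. The points of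
  the 3-cycle become the reciprocals of the roots of \<open>Q\<^sub>\<beta>\<close>, on which this map agrees with the
  Moebius map \<open>p \<mapsto> -1 / (p + 1)\<close> of order 3. The derivative of the third iterate along the cycle is
  \<open>\<mu> = 1 - 7\<beta> - \<beta>\<^sup>2 - \<beta>\<^sup>3\<close>, and \<open>\<delta>\<^sub>n\<^sub>h = s\<^sup>2\<close> where \<open>s\<close> is the real root of \<open>\<mu> = -1\<close> (Cardano). This settles all
  cases with \<open>\<bar>\<mu>\<bar> \<noteq> 1\<close>. For \<open>\<beta> = 0\<close>, where \<open>\<mu> = 1\<close>, the two cycles have merged, so the displacement of the
  third iterate has a double zero at the cycle points and keeps its sign nearby: points on one side
  drift away. For \<open>\<mu> = -1\<close> the third iterate has the local form \<open>d \<mapsto> -d + A d\<^sup>2 + B d\<^sup>3 + O(d\<^sup>4)\<close>, and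
  \<open>A\<^sup>2 + B\<close> is a positive sum of squares (the Schwarzian derivative is negative), which makes
  \<open>\<bar>d - (A / 2) d\<^sup>2\<bar>\<close> a strict Lyapunov function.
\<close>

section \<open>Stability criteria for a fixed point of a real map\<close>

definition stable_fixpoint :: "(real \<Rightarrow> real) \<Rightarrow> real \<Rightarrow> bool" where
  "stable_fixpoint f x0 \<longleftrightarrow>
     (\<forall>e>0. \<exists>d>0. \<forall>x. \<bar>x - x0\<bar> < d \<longrightarrow> (\<forall>t. \<bar>(f ^^ t) x - x0\<bar> < e))"

definition attracting_fixpoint :: "(real \<Rightarrow> real) \<Rightarrow> real \<Rightarrow> bool" where
  "attracting_fixpoint f x0 \<longleftrightarrow>
     (\<exists>d>0. \<forall>x. \<bar>x - x0\<bar> < d \<longrightarrow> (\<lambda>t. (f ^^ t) x) \<longlonglongrightarrow> x0)"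

lemma lyapunov_stable_point_iff:
  "lyapunov_stable_point g x \<longleftrightarrow> (g ^^ 3) x = x \<and> stable_fixpoint (g ^^ 3) x"
  by (simp add: lyapunov_stable_point_def stable_fixpoint_def funpow_mult)

lemma attracting_point_iff: "attracting_point g x \<longleftrightarrow> attracting_fixpoint (g ^^ 3) x"
  by (simp add: attracting_point_def attracting_fixpoint_def funpow_mult)

text \<open>Near \<open>x0\<close> each step stretches the distance to \<open>x0\<close> by a factor
  \<open>l\<close> strictly between 1 and \<open>\<bar>\<mu>\<bar>\<close>. A confined orbit would
  thus grow geometrically.\<close>

lemma unstable_if_multiplier_gt_1:
  assumes D: "(f has_real_derivative \<mu>) (at x0)" and fp: "f x0 = x0" and \<mu>: "\<bar>\<mu>\<bar> > 1"
  shows "\<not> stable_fixpoint f x0"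
proof
  assume "stable_fixpoint f x0"
  define l where "l = (1 + \<bar>\<mu>\<bar>) / 2"
  have l: "l > 1" "l < \<bar>\<mu>\<bar>" using \<mu> by (auto simp: l_def)
  have "((\<lambda>y. \<bar>(f y - f x0) / (y - x0)\<bar>) \<longlongrightarrow> \<bar>\<mu>\<bar>) (at x0)"
    using D by (intro tendsto_rabs) (simp add: has_field_derivative_iff)
  then have "\<forall>\<^sub>F y in at x0. \<bar>(f y - f x0) / (y - x0)\<bar> > l"
    using l by (simp add: order_tendstoD)
  then obtain r where r: "r > 0" "\<And>y. y \<noteq> x0 \<Longrightarrow> \<bar>y - x0\<bar> < r \<Longrightarrow> \<bar>(f y - f x0) / (y - x0)\<bar> > l"
    by (auto simp: eventually_at dist_real_def)
  have expand: "\<bar>f y - x0\<bar> \<ge> l * \<bar>y - x0\<bar>" if "\<bar>y - x0\<bar> < r" for y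
  proof (cases "y = x0")
    case False
    with r(2)[OF False that] show ?thesis by (simp add: fp abs_divide field_simps)
  qed (simp add: fp)
  obtain d where d: "d > 0" "\<And>x t. \<bar>x - x0\<bar> < d \<Longrightarrow> \<bar>(f ^^ t) x - x0\<bar> < r"
    using \<open>stable_fixpoint f x0\<close> r(1) unfolding stable_fixpoint_def by blast
  define x where "x = x0 + d / 2"
  have x: "\<bar>x - x0\<bar> < d" "\<bar>x - x0\<bar> = d / 2" using d(1) by (auto simp: x_def)
  have grow: "l ^ t * (d / 2) \<le> \<bar>(f ^^ t) x - x0\<bar>" for t
  proof (induction t)
    case (Suc t)
    have "l ^ Suc t * (d / 2) = l * (l ^ t * (d / 2))" by simp
    also have "\<dots> \<le> l * \<bar>(f ^^ t) x - x0\<bar>" using Suc l by (intro mult_left_mono) auto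
    also have "\<dots> \<le> \<bar>(f ^^ Suc t) x - x0\<bar>" using expand[OF d(2)[OF x(1)]] by simp
    finally show ?case .
  qed (simp add: x)
  obtain n where "2 * r / d < l ^ n" using real_arch_pow[OF l(1)] by blast
  then have "r < l ^ n * (d / 2)" using d(1) by (simp add: field_simps)
  with grow[of n] d(2)[OF x(1), of n] show False by simp
qed

text \<open>On both sides of \<open>x0\<close> points move in the direction given by the sign of
  \<open>s\<close>. An orbit started on the side that leads away is monotone while confined, so it
  converges to a fixed point other than \<open>x0\<close>, which the drift excludes.\<close>

lemma unstable_if_one_sided_drift:
  assumes cont: "\<And>x. isCont f x" and fp: "f x0 = x0"
    and drift: "\<forall>\<^sub>F x in at x0. s * (f x - x) > 0"
  shows "\<not> stable_fixpoint f x0"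
proof
  assume "stable_fixpoint f x0"
  obtain r where r: "r > 0" "\<And>x. x \<noteq> x0 \<Longrightarrow> \<bar>x - x0\<bar> < r \<Longrightarrow> s * (f x - x) > 0"
    using drift by (auto simp: eventually_at dist_real_def)
  have s: "s \<noteq> 0" using r(2)[of "x0 + r / 2"] r(1) by auto
  obtain d where d: "d > 0" "\<And>x t. \<bar>x - x0\<bar> < d \<Longrightarrow> \<bar>(f ^^ t) x - x0\<bar> < r / 2"
    using \<open>stable_fixpoint f x0\<close> half_gt_zero[OF r(1)] unfolding stable_fixpoint_def by blast
  \<comment> \<open>The factor \<open>sgn s\<close> picks the outward side; \<open>y\<close> is
    \<open>\<bar>s\<bar>\<close> times the distance measured positively in that direction.\<close>
  define x where "x = x0 + sgn s * (d / 2)"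
  define y where "y t = s * ((f ^^ t) x - x0)" for t
  have x: "\<bar>x - x0\<bar> < d" using d(1) s by (auto simp: x_def abs_mult sgn_if)
  note near = d(2)[OF x]
  have y0: "y 0 > 0" using d(1) s by (auto simp: y_def x_def sgn_if mult_neg_pos)
  have step: "y t \<le> y (Suc t)" for t
  proof (cases "(f ^^ t) x = x0")
    case False
    have "s * (f ((f ^^ t) x) - (f ^^ t) x) > 0"
      using r(2)[OF False] near[of t] r(1) by simp
    then show ?thesis by (simp add: y_def algebra_simps)
  qed (simp add: y_def fp)
  then have inc: "incseq y" by (rule incseq_SucI)
  have ybd: "y t \<le> \<bar>s\<bar> * (r / 2)" for t
  proof -
    have "y t \<le> \<bar>s\<bar> * \<bar>(f ^^ t) x - x0\<bar>" unfolding y_def by (metis abs_ge_self abs_mult)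
    also have "\<dots> \<le> \<bar>s\<bar> * (r / 2)" using near[of t] by (intro mult_left_mono) auto
    finally show ?thesis .
  qed
  obtain L where L: "y \<longlonglongrightarrow> L" "\<And>t. y t \<le> L"
    using incseq_convergent[OF inc, of "\<bar>s\<bar> * (r / 2)"] ybd by auto
  define z where "z = x0 + L / s"
  have lim: "(\<lambda>t. (f ^^ t) x) \<longlonglongrightarrow> z"
  proof -
    have "(\<lambda>t. x0 + y t / s) \<longlonglongrightarrow> z" unfolding z_def using s by (intro tendsto_intros L)
    then show ?thesis using s by (simp add: y_def)
  qed
  have "(\<lambda>t. f ((f ^^ t) x)) \<longlonglongrightarrow> f z" using isCont_tendsto_compose[OF cont lim] .
  moreover have "(\<lambda>t. f ((f ^^ t) x)) \<longlonglongrightarrow> z" using LIMSEQ_Suc[OF lim] by simp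
  ultimately have fz: "f z = z" by (rule LIMSEQ_unique)
  have "L > 0" using y0 L(2)[of 0] by simp
  then have "z \<noteq> x0" using s by (simp add: z_def)
  moreover have "\<bar>z - x0\<bar> \<le> r / 2"
  proof (rule LIMSEQ_le_const2)
    show "(\<lambda>t. \<bar>(f ^^ t) x - x0\<bar>) \<longlonglongrightarrow> \<bar>z - x0\<bar>" by (intro tendsto_intros lim)
    show "\<exists>N. \<forall>n\<ge>N. \<bar>(f ^^ n) x - x0\<bar> \<le> r / 2" using near less_imp_le by blast
  qed
  ultimately show False using r(2)[of z] r(1) fz by simp
qed

text \<open>The cubic rate is weak enough to serve multiplier -1 as well. Telescoping the decrease
  makes the cubed distances along an orbit summable, so the distances tend to 0.\<close>

lemma asymptotically_stable_if_lyapunov_function: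
  assumes cont: "isCont f x0" and fp: "f x0 = x0" and c: "c > 0"
    and W: "\<forall>\<^sub>F x in nhds x0. \<bar>x - x0\<bar> \<le> 2 * W x \<and> W x \<le> 2 * \<bar>x - x0\<bar>"
    and dec: "\<forall>\<^sub>F x in nhds x0. W (f x) \<le> W x - c * \<bar>x - x0\<bar> ^ 3"
  shows "stable_fixpoint f x0 \<and> attracting_fixpoint f x0"
proof -
  \<comment> \<open>Continuity gives this bound at \<open>f x\<close> in advance: the induction
    below needs it before \<open>f x\<close> is known to lie within distance \<open>r\<close> of
    \<open>x0\<close>.\<close>
  have "\<forall>\<^sub>F x in nhds x0. \<bar>f x - x0\<bar> \<le> 2 * W (f x)"
  proof -
    have "filterlim f (nhds x0) (nhds x0)"
      using cont fp tendsto_at_iff_tendsto_nhds[of f x0] by (simp add: isCont_def)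
    moreover have "\<forall>\<^sub>F x in nhds x0. \<bar>x - x0\<bar> \<le> 2 * W x" using W by (rule eventually_mono) simp
    ultimately show ?thesis by (rule eventually_compose_filterlim[rotated])
  qed
  with W dec have "\<forall>\<^sub>F x in nhds x0. (\<bar>x - x0\<bar> \<le> 2 * W x \<and> W x \<le> 2 * \<bar>x - x0\<bar>) \<and>
      W (f x) \<le> W x - c * \<bar>x - x0\<bar> ^ 3 \<and> \<bar>f x - x0\<bar> \<le> 2 * W (f x)"
    by eventually_elim simp
  then obtain r where r: "r > 0" and near: "\<forall>x. dist x x0 < r \<longrightarrow>
      (\<bar>x - x0\<bar> \<le> 2 * W x \<and> W x \<le> 2 * \<bar>x - x0\<bar>) \<and>
      W (f x) \<le> W x - c * \<bar>x - x0\<bar> ^ 3 \<and> \<bar>f x - x0\<bar> \<le> 2 * W (f x)"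
    unfolding eventually_nhds_metric by blast
  have W1: "\<bar>x - x0\<bar> \<le> 2 * W x" and W2: "W x \<le> 2 * \<bar>x - x0\<bar>"
    and W3: "W (f x) \<le> W x - c * \<bar>x - x0\<bar> ^ 3" and W4: "\<bar>f x - x0\<bar> \<le> 2 * W (f x)"
    if "\<bar>x - x0\<bar> < r" for x
    using near[unfolded dist_real_def, rule_format, OF that] by blast+
  \<comment> \<open>The radius \<open>e / 4\<close> absorbs the two comparison factors 2: initially
    \<open>W x < e / 2\<close>, and later the distance is at most \<open>2 * W\<close>.\<close>
  have orbit: "\<bar>(f ^^ t) x - x0\<bar> < e \<and>
      W ((f ^^ t) x) + (\<Sum>i<t. c * \<bar>(f ^^ i) x - x0\<bar> ^ 3) \<le> W x"
    if x: "\<bar>x - x0\<bar> < e / 4" and e: "e \<le> r" for x e t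
  proof (induction t)
    case 0
    have "\<bar>x - x0\<bar> < e" using x by linarith
    then show ?case by simp
  next
    case (Suc t)
    let ?y = "(f ^^ t) x"
    have IH1: "\<bar>?y - x0\<bar> < e"
      and IH2: "W ?y + (\<Sum>i<t. c * \<bar>(f ^^ i) x - x0\<bar> ^ 3) \<le> W x"
      using Suc.IH by blast+
    have y: "\<bar>?y - x0\<bar> < r" using IH1 e by (rule less_le_trans)
    have "0 \<le> (\<Sum>i<t. c * \<bar>(f ^^ i) x - x0\<bar> ^ 3)" using c by (intro sum_nonneg) simp
    moreover have "0 \<le> c * \<bar>?y - x0\<bar> ^ 3" using c by simp
    ultimately have "W (f ?y) \<le> W x" using W3[OF y] IH2 by linarith
    moreover have "W x < e / 2"
    proof -
      have "\<bar>x - x0\<bar> < r" using x e by linarith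
      from W2[OF this] have "W x \<le> 2 * \<bar>x - x0\<bar>" .
      also have "\<dots> < 2 * (e / 4)" using x by (intro mult_strict_left_mono) simp_all
      finally show ?thesis by simp
    qed
    ultimately have "2 * W (f ?y) < e" by linarith
    with W4[OF y] have "\<bar>f ?y - x0\<bar> < e" by (rule le_less_trans)
    moreover have "W (f ?y) + (\<Sum>i<Suc t. c * \<bar>(f ^^ i) x - x0\<bar> ^ 3) \<le> W x"
      unfolding sum.lessThan_Suc using W3[OF y] IH2 by linarith
    ultimately show ?case by (simp only: funpow.simps o_apply)
  qed
  have "stable_fixpoint f x0"
    unfolding stable_fixpoint_def
  proof (intro allI impI)
    fix e :: real assume "e > 0"
    show "\<exists>d>0. \<forall>x. \<bar>x - x0\<bar> < d \<longrightarrow> (\<forall>t. \<bar>(f ^^ t) x - x0\<bar> < e)"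
    proof (intro exI[of _ "min e r / 4"] conjI allI impI)
      show "min e r / 4 > 0" using \<open>e > 0\<close> r by simp
      show "\<bar>(f ^^ t) x - x0\<bar> < e" if "\<bar>x - x0\<bar> < min e r / 4" for x t
        using orbit[OF that min.cobounded2, of t] by (metis min_less_iff_conj)
    qed
  qed
  moreover have "(\<lambda>t. (f ^^ t) x) \<longlonglongrightarrow> x0" if x: "\<bar>x - x0\<bar> < r / 4" for x
  proof -
    let ?u = "\<lambda>t. c * \<bar>(f ^^ t) x - x0\<bar> ^ 3"
    have "summable ?u"
    proof (rule summableI_nonneg_bounded)
      show "0 \<le> ?u t" for t using c by simp
      show "sum ?u {..<t} \<le> W x" for t
      proof -
        have *: "\<bar>(f ^^ t) x - x0\<bar> < r" "W ((f ^^ t) x) + sum ?u {..<t} \<le> W x"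
          using orbit[OF x order_refl] by blast+
        have "0 \<le> \<bar>(f ^^ t) x - x0\<bar>" by simp
        also have "\<dots> \<le> 2 * W ((f ^^ t) x)" by (rule W1[OF *(1)])
        finally show ?thesis using *(2) by linarith
      qed
    qed
    then have "?u \<longlonglongrightarrow> 0" by (rule summable_LIMSEQ_zero)
    then have "(\<lambda>t. ?u t / c) \<longlonglongrightarrow> 0 / c" using c by (intro tendsto_divide tendsto_const) auto
    then have "(\<lambda>t. \<bar>(f ^^ t) x - x0\<bar> ^ 3) \<longlonglongrightarrow> 0" using c by simp
    then have "(\<lambda>t. root 3 (\<bar>(f ^^ t) x - x0\<bar> ^ 3)) \<longlonglongrightarrow> root 3 0" by (rule tendsto_real_root)
    then have "(\<lambda>t. \<bar>(f ^^ t) x - x0\<bar>) \<longlonglongrightarrow> 0" by (simp add: real_root_power_cancel)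
    then show ?thesis by (rule LIM_zero_cancel[OF tendsto_rabs_zero_cancel])
  qed
  then have "attracting_fixpoint f x0"
    unfolding attracting_fixpoint_def using r by (intro exI[of _ "r / 4"] conjI allI impI) simp_all
  ultimately show ?thesis ..
qed

text \<open>The distance itself is a Lyapunov function: it drops at a linear rate, which dominates
  the cubic one at distances below 1.\<close>

lemma asymptotically_stable_if_multiplier_lt_1:
  assumes D: "(f has_real_derivative \<mu>) (at x0)" and fp: "f x0 = x0" and \<mu>: "\<bar>\<mu>\<bar> < 1"
  shows "stable_fixpoint f x0 \<and> attracting_fixpoint f x0"
proof (rule asymptotically_stable_if_lyapunov_function[where W = "\<lambda>x. \<bar>x - x0\<bar>"])
  define l where "l = (1 + \<bar>\<mu>\<bar>) / 2"
  have l: "l < 1" "l > \<bar>\<mu>\<bar>" using \<mu> by (auto simp: l_def)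
  show "isCont f x0" using D DERIV_isCont by blast
  show "f x0 = x0" by fact
  show "1 - l > 0" using l by simp
  show "\<forall>\<^sub>F x in nhds x0. \<bar>x - x0\<bar> \<le> 2 * \<bar>x - x0\<bar> \<and> \<bar>x - x0\<bar> \<le> 2 * \<bar>x - x0\<bar>" by simp
  have "((\<lambda>y. \<bar>(f y - f x0) / (y - x0)\<bar>) \<longlongrightarrow> \<bar>\<mu>\<bar>) (at x0)"
    using D by (intro tendsto_rabs) (simp add: has_field_derivative_iff)
  then have "\<forall>\<^sub>F y in at x0. \<bar>(f y - f x0) / (y - x0)\<bar> < l"
    using l by (simp add: order_tendstoD)
  moreover have "\<forall>\<^sub>F y in at x0. \<bar>y - x0\<bar> < 1" by (auto simp: eventually_at dist_real_def intro: exI[of _ 1])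
  moreover have "\<forall>\<^sub>F y in at x0. y \<noteq> x0" by (rule eventually_neq_at_within)
  ultimately have "\<forall>\<^sub>F y in at x0. \<bar>f y - x0\<bar> \<le> \<bar>y - x0\<bar> - (1 - l) * \<bar>y - x0\<bar> ^ 3"
  proof eventually_elim
    case (elim y)
    have "(1 - l) * \<bar>y - x0\<bar> ^ 3 \<le> (1 - l) * \<bar>y - x0\<bar> ^ 1"
      using elim l by (intro mult_left_mono power_decreasing) auto
    moreover have "\<bar>f y - x0\<bar> \<le> l * \<bar>y - x0\<bar>"
      using elim by (simp add: fp abs_divide field_simps)
    ultimately show ?case by (simp add: algebra_simps)
  qed
  then show "\<forall>\<^sub>F y in nhds x0. \<bar>f y - x0\<bar> \<le> \<bar>y - x0\<bar> - (1 - l) * \<bar>y - x0\<bar> ^ 3"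
    by (simp add: eventually_nhds_conv_at fp)
qed

lemma asymptotically_stable_if_multiplier_minus_1:
  assumes f: "\<And>d. f (x0 + d) = x0 - d + A * d ^ 2 + B * d ^ 3 + P d * d ^ 4"
    and P: "isCont P 0" and C: "A\<^sup>2 + B > 0"
  shows "stable_fixpoint f x0 \<and> attracting_fixpoint f x0"
proof -
  define C where "C = A\<^sup>2 + B"
  \<comment> \<open>This change of variable removes the quadratic term: \<open>V\<close> turns \<open>f\<close> into \<open>- V + C d\<^sup>3 + O(d\<^sup>4)\<close>.\<close>
  define V where "V d = d - A / 2 * d\<^sup>2" for d
  define T where "T d = P d + A * B + A * P d * d - A / 2 * (A + B * d + P d * d\<^sup>2)\<^sup>2" for d
  have VT: "V (f (x0 + d) - x0) = - V d + C * d ^ 3 + T d * d ^ 4" for d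
    unfolding V_def T_def C_def f by algebra
  have idl: "((\<lambda>d::real. d) \<longlongrightarrow> 0) (nhds 0)" by (simp add: filterlim_ident)
  have Pl: "(P \<longlongrightarrow> P 0) (nhds 0)"
    using P by (simp add: isCont_def tendsto_at_iff_tendsto_nhds)
  have T: "(T \<longlongrightarrow> T 0) (nhds 0)"
    unfolding T_def by (intro tendsto_intros Pl idl)
  have shift: "\<forall>\<^sub>F x in nhds x0. Q (x - x0)" if "\<forall>\<^sub>F d in nhds 0. Q d" for Q
  proof -
    have "filterlim (\<lambda>x. x - x0) (nhds 0) (nhds x0)"
      by (rule tendsto_eq_intros filterlim_ident refl | simp)+
    then show ?thesis using that by (rule eventually_compose_filterlim[rotated])
  qed
  \<comment> \<open>Three smallness conditions: this one makes \<open>\<bar>V d\<bar>\<close>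
    comparable to \<open>\<bar>d\<bar>\<close>, \<open>small2\<close> retains half of the cubic
    gain, and \<open>small3\<close> bounds the correction so that the factor of \<open>-d\<close> in
    \<open>V (f (x0 + d) - x0)\<close> stays positive.\<close>
  have small1: "\<forall>\<^sub>F d in nhds 0. \<bar>A / 2 * d\<bar> < 1 / 2"
  proof -
    have "((\<lambda>d. \<bar>A / 2 * d\<bar>) \<longlongrightarrow> \<bar>A / 2 * 0\<bar>) (nhds 0)" by (intro tendsto_intros idl)
    then show ?thesis by (rule order_tendstoD) simp
  qed
  have small2: "\<forall>\<^sub>F d in nhds 0. d * T d > - (C / 2)"
  proof -
    have "((\<lambda>d. d * T d) \<longlongrightarrow> 0 * T 0) (nhds 0)" by (intro tendsto_intros idl T)
    then show ?thesis by (rule order_tendstoD) (use assms C_def in simp)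
  qed
  have small3: "\<forall>\<^sub>F d in nhds 0. d ^ 2 * (C + d * T d) < 1 / 2"
  proof -
    have "((\<lambda>d. d ^ 2 * (C + d * T d)) \<longlongrightarrow> 0 ^ 2 * (C + 0 * T 0)) (nhds 0)" by (intro tendsto_intros idl T)
    then show ?thesis by (rule order_tendstoD) simp
  qed
  have absV: "\<bar>V d\<bar> = \<bar>d\<bar> * (1 - A / 2 * d)" if "\<bar>A / 2 * d\<bar> < 1 / 2" for d
  proof -
    have "V d = d * (1 - A / 2 * d)" by (simp add: V_def algebra_simps power2_eq_square)
    moreover have "1 - A / 2 * d > 0" using that by linarith
    ultimately show ?thesis by (simp only: abs_mult abs_of_pos)
  qed
  show ?thesis
  proof (rule asymptotically_stable_if_lyapunov_function[where W = "\<lambda>x. \<bar>V (x - x0)\<bar>" and c = "C / 2"])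
    have eq: "f = (\<lambda>x. x0 - (x - x0) + A * (x - x0) ^ 2 + B * (x - x0) ^ 3 + P (x - x0) * (x - x0) ^ 4)"
    proof
      show "f x = x0 - (x - x0) + A * (x - x0) ^ 2 + B * (x - x0) ^ 3 + P (x - x0) * (x - x0) ^ 4" for x
        using f[of "x - x0"] by (simp only: add_diff_cancel_left' diff_add_cancel add.commute[of x0])
    qed
    have "isCont (\<lambda>x. P (x - x0)) x0"
      by (rule isCont_o2[where f = "\<lambda>x. x - x0" and g = P]) (use P in \<open>simp_all add: continuous_intros\<close>)
    then show "isCont f x0" unfolding eq by (intro continuous_intros) auto
    show "f x0 = x0" using f[of 0] by simp
    show "C / 2 > 0" using assms C_def by simp
    have "\<forall>\<^sub>F d in nhds 0. \<bar>d\<bar> \<le> 2 * \<bar>V d\<bar> \<and> \<bar>V d\<bar> \<le> 2 * \<bar>d\<bar>"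
      using small1
    proof eventually_elim
      case (elim d)
      have "1 - A / 2 * d \<le> 2" using elim by linarith
      then have "\<bar>d\<bar> * (1 - A / 2 * d) \<le> \<bar>d\<bar> * 2" by (rule mult_left_mono) simp
      moreover have "1 / 2 \<le> 1 - A / 2 * d" using elim by linarith
      then have "\<bar>d\<bar> * (1 / 2) \<le> \<bar>d\<bar> * (1 - A / 2 * d)" by (rule mult_left_mono) simp
      ultimately show ?case unfolding absV[OF elim] by linarith
    qed
    from shift[OF this]
    show "\<forall>\<^sub>F x in nhds x0. \<bar>x - x0\<bar> \<le> 2 * \<bar>V (x - x0)\<bar> \<and> \<bar>V (x - x0)\<bar> \<le> 2 * \<bar>x - x0\<bar>" .
    have "\<forall>\<^sub>F d in nhds 0. \<bar>V (f (x0 + d) - x0)\<bar> \<le> \<bar>V d\<bar> - C / 2 * \<bar>d\<bar> ^ 3"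
      using small1 small2 small3
    proof eventually_elim
      case (elim d)
      have "V (f (x0 + d) - x0) = - (d * ((1 - A / 2 * d) - d ^ 2 * (C + d * T d)))"
        unfolding VT unfolding V_def by algebra
      moreover have "1 - A / 2 * d - d ^ 2 * (C + d * T d) > 0" using elim by linarith
      ultimately have "\<bar>V (f (x0 + d) - x0)\<bar> = \<bar>d\<bar> * ((1 - A / 2 * d) - d ^ 2 * (C + d * T d))"
        by (simp only: abs_minus_cancel abs_mult abs_of_pos)
      also have "\<dots> = \<bar>V d\<bar> - \<bar>d\<bar> ^ 3 * (C + d * T d)"
        unfolding absV[OF elim(1)] using power2_abs[of d] by algebra
      also have "\<dots> \<le> \<bar>V d\<bar> - \<bar>d\<bar> ^ 3 * (C / 2)"
        using elim(2) by (intro diff_left_mono mult_left_mono) (linarith, simp)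
      finally show ?case by (simp only: mult.commute)
    qed
    from shift[OF this]
    show "\<forall>\<^sub>F x in nhds x0. \<bar>V (f x - x0)\<bar> \<le> \<bar>V (x - x0)\<bar> - C / 2 * \<bar>x - x0\<bar> ^ 3" by simp
  qed
qed

section \<open>The normal form and the cubic of its 3-cycle\<close>

definition cycle_poly :: "real \<Rightarrow> real \<Rightarrow> real" where
  "cycle_poly \<beta> p = p ^ 3 + (2 + \<beta>) * p\<^sup>2 + (\<beta> - 1) * p - 1"

definition cycle_map :: "real \<Rightarrow> real \<Rightarrow> real" where
  "cycle_map \<beta> p = p\<^sup>2 + (\<beta> + 1) * p - 2"

text \<open>Hence at a zero \<open>p\<close> of the cubic the quadratic map takes the value
  \<open>-1 / (p + 1)\<close>. The cubic is Shanks's simplest cubic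
  \<open>x^3 - k x^2 - (k + 3) x - 1\<close> with \<open>k = -(2 + \<beta>)\<close>, whose zeros
  this Moebius map permutes.\<close>

lemma cycle_poly_eq: "cycle_poly \<beta> p = (p + 1) * cycle_map \<beta> p + 1"
  by (simp add: cycle_poly_def cycle_map_def algebra_simps power2_eq_square power3_eq_cube)

lemma cycle_poly_cycle_map:
  assumes "cycle_poly \<beta> p = 0"
  shows "cycle_poly \<beta> (cycle_map \<beta> p) = 0"
  using assms unfolding cycle_poly_def cycle_map_def by algebra

lemma cycle_map_period_3:
  assumes "cycle_poly \<beta> p = 0"
  shows "cycle_map \<beta> (cycle_map \<beta> (cycle_map \<beta> p)) = p"
  using assms unfolding cycle_poly_def cycle_map_def by algebra

text \<open>The Moebius map has no real fixed point, as \<open>p^2 + p + 1\<close> has no real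
  zero.\<close>

lemma cycle_map_neq:
  assumes "cycle_poly \<beta> p = 0"
  shows "cycle_map \<beta> p \<noteq> p"
proof
  assume "cycle_map \<beta> p = p"
  then have "p\<^sup>2 + p + 1 = 0" using assms cycle_poly_eq[of \<beta> p] by (simp add: algebra_simps power2_eq_square)
  moreover have "p\<^sup>2 + p + 1 = (p + 1 / 2)\<^sup>2 + 3 / 4" by (simp add: field_simps power2_eq_square)
  ultimately show False using zero_le_power2[of "p + 1 / 2"] by linarith
qed

lemma cycle_poly_factor:
  assumes "cycle_poly \<beta> p = 0"
  shows "cycle_poly \<beta> x =
    (x - p) * (x - cycle_map \<beta> p) * (x - cycle_map \<beta> (cycle_map \<beta> p))"
  using assms unfolding cycle_poly_def cycle_map_def by algebra

text \<open>The factors are the derivatives of \<open>cycle_map \<beta>\<close> along the cycle. By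
  the factorisation of the cubic their product is -8 times its value at
  \<open>-(1 + \<beta>) / 2\<close>.\<close>

lemma cycle_multiplier:
  assumes "cycle_poly \<beta> p = 0"
  shows "(2 * p + 1 + \<beta>) * (2 * cycle_map \<beta> p + 1 + \<beta>) * (2 * cycle_map \<beta> (cycle_map \<beta> p) + 1 + \<beta>) =
    1 - 7 * \<beta> - \<beta>\<^sup>2 - \<beta> ^ 3"
  using assms unfolding cycle_poly_def cycle_map_def by algebra

text \<open>For general \<open>\<beta>\<close> the square splits into the two factors belonging to \<open>\<beta>\<close> and \<open>- \<beta>\<close>.\<close>
lemma cycle_map_iterate_saddle_node:
  "cycle_map 0 (cycle_map 0 (cycle_map 0 p)) - p =
    (cycle_map 0 p - p) * (cycle_poly 0 p)\<^sup>2"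
  unfolding cycle_poly_def cycle_map_def by algebra

lemma cycle_poly_has_root: "\<exists>p. cycle_poly \<beta> p = 0"
proof -
  have "cycle_poly \<beta> (-1) = 1" "cycle_poly \<beta> 0 = -1" by (simp_all add: cycle_poly_def)
  moreover have "continuous_on {-1..0} (cycle_poly \<beta>)" unfolding cycle_poly_def by (intro continuous_intros)
  ultimately show ?thesis using IVT2'[of "cycle_poly \<beta>" 0 0 "-1"] by auto
qed

lemma delta_nh_root:
  obtains s where "s > 0" "delta_nh = s\<^sup>2" "s ^ 3 + s\<^sup>2 + 7 * s = 2"
proof -
  define u :: real where "u = 460 + 60 * sqrt 201"
  define w where "w = u powr (1 / 3)"
  define s where "s = (w\<^sup>2 - 2 * w - 80) / (6 * w)"
  have u: "u > 0" by (simp add: u_def add_pos_pos)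
  have w: "w > 0" using u by (simp add: w_def)
  have w2: "u powr (2 / 3) = w\<^sup>2"
    using u by (simp add: w_def powr_power)
  have w3: "w ^ 3 = u" using u by (simp add: w_def powr_power)
  have "(u - 460)\<^sup>2 = 3600 * 201" by (simp add: u_def power_mult_distrib)
  \<comment> \<open>Since 512000 is the cube of 80, \<open>w ^ 3\<close> and
    \<open>-(80 / w) ^ 3\<close> are the two roots of Cardano's resolvent quadratic.\<close>
  then have w6: "w ^ 6 - 920 * w ^ 3 - 512000 = 0"
    unfolding w3[symmetric] by algebra
  have ws: "6 * w * s = w\<^sup>2 - 2 * w - 80" using w by (simp add: s_def)
  \<comment> \<open>With \<open>y = w - 80 / w = 6 s + 2\<close>, both equations amount to \<open>y\<^sup>3 + 240 y = 920\<close>.\<close>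
  have "216 * w ^ 3 * (s ^ 3 + s\<^sup>2 + 7 * s - 2) = 0"
    using w6 ws by algebra
  then have eq: "s ^ 3 + s\<^sup>2 + 7 * s = 2" using w by simp
  have "s * (s\<^sup>2 + s + 7) = 2" using eq by (simp add: algebra_simps power2_eq_square power3_eq_cube)
  moreover have "s\<^sup>2 + s + 7 > 0"
  proof -
    have "s\<^sup>2 + s + 7 = (s + 1 / 2)\<^sup>2 + 27 / 4" by (simp add: field_simps power2_eq_square)
    then show ?thesis using zero_le_power2[of "s + 1 / 2"] by linarith
  qed
  ultimately have "s > 0" by (metis zero_less_mult_pos2 zero_less_numeral)
  moreover have "delta_nh = s\<^sup>2"
    unfolding delta_nh_def u_def[symmetric] w2 w_def[symmetric] s_def
    by (simp add: power_divide power_mult_distrib)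
  ultimately show thesis using eq that by blast
qed

section \<open>Identifying the cycles given by the roots of \<open>Q_poly\<close>\<close>

lemma cycle_poly_roots:
  assumes "cycle_poly \<beta> p = 0"
  shows "{x. cycle_poly \<beta> x = 0} = {p, cycle_map \<beta> p, cycle_map \<beta> (cycle_map \<beta> p)}" "card {p, cycle_map \<beta> p, cycle_map \<beta> (cycle_map \<beta> p)} = 3"
proof -
  show "{x. cycle_poly \<beta> x = 0} = {p, cycle_map \<beta> p, cycle_map \<beta> (cycle_map \<beta> p)}"
    using cycle_poly_factor[OF assms] by auto
  have "cycle_map \<beta> p \<noteq> p" "cycle_map \<beta> (cycle_map \<beta> p) \<noteq> cycle_map \<beta> p" using cycle_map_neq cycle_poly_cycle_map assms by blast+
  moreover have "cycle_map \<beta> (cycle_map \<beta> p) \<noteq> p" using cycle_map_period_3[OF assms] calculation by metis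
  ultimately show "card {p, cycle_map \<beta> p, cycle_map \<beta> (cycle_map \<beta> p)} = 3" by simp
qed

lemma Q_poly_root_iff: "poly (Q_poly \<beta>) q = 0 \<longleftrightarrow> q \<noteq> 0 \<and> cycle_poly \<beta> (1 / q) = 0"
proof (cases "q = 0")
  case False
  have "poly (Q_poly \<beta>) q = - (q ^ 3 * cycle_poly \<beta> (1 / q))"
    using False by (simp add: Q_poly_def cycle_poly_def field_simps power2_eq_square power3_eq_cube)
  then show ?thesis using False by simp
qed (simp add: Q_poly_def)

lemma Q_poly_roots: "{q. poly (Q_poly \<beta>) q = 0} = inverse ` {p. cycle_poly \<beta> p = 0}"
proof (intro equalityI subsetI)
  fix q assume "q \<in> {q. poly (Q_poly \<beta>) q = 0}"
  then show "q \<in> inverse ` {p. cycle_poly \<beta> p = 0}"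
    by (intro image_eqI[of _ _ "1 / q"]) (auto simp: Q_poly_root_iff)
next
  fix q assume "q \<in> inverse ` {p. cycle_poly \<beta> p = 0}"
  then obtain p where p: "cycle_poly \<beta> p = 0" "q = inverse p" by auto
  then have "p \<noteq> 0" by (auto simp: cycle_poly_def)
  then show "q \<in> {q. poly (Q_poly \<beta>) q = 0}" using p by (simp add: Q_poly_root_iff divide_inverse)
qed

text \<open>Three distinct roots give the sorted list exactly the positions 0, 1, 2, which the shift
  \<open>i - 1\<close> runs through.\<close>

lemma q_root_image: "q_root \<beta> ` {1, 2, 3} = {q. poly (Q_poly \<beta>) q = 0}"
proof -
  let ?S = "{q. poly (Q_poly \<beta>) q = 0}"
  obtain p where p: "cycle_poly \<beta> p = 0" using cycle_poly_has_root by blast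
  have "card ?S = card {p. cycle_poly \<beta> p = 0}"
    unfolding Q_poly_roots by (rule card_image) (simp add: inj_on_def)
  then have card: "card ?S = 3" using cycle_poly_roots[OF p] by simp
  then have fin: "finite ?S" by (intro card_ge_0_finite) simp
  have len: "length (sorted_list_of_set ?S) = 3" using card by simp
  have "?S = set (sorted_list_of_set ?S)" using fin by simp
  also have "\<dots> = (\<lambda>i. sorted_list_of_set ?S ! i) ` {0..<3}"
    using len by (metis list.set_map map_nth set_upt)
  also have "{0..<3} = (\<lambda>i. i - 1) ` {1, 2, 3::nat}" by auto
  finally show ?thesis by (auto simp: q_root_def)
qed

text \<open>The map \<open>g\<close> itself orders the points, so a cycle can be recovered from its
  point set. This supplies uniqueness for the definite description in
  \<open>cycle_of\<close>.\<close>

lemma three_cycle_eq_image: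
  assumes "C \<in> three_cycles g"
  shows "C = (\<lambda>w. (w, g w, g (g w))) ` cycle_points C"
  using assms unfolding three_cycles_def
  by (auto simp: three_cycle_triple_def cyclic_class_def cycle_points_def)

lemma cycle_of_eqI:
  assumes "C \<in> three_cycles g"
    and "cycle_points C = (\<lambda>i. (- b + \<beta> + 1) / (2 * a) + 1 / (a * q_root \<beta> i)) ` {1, 2, 3}"
  shows "cycle_of g a b \<beta> = C"
  unfolding cycle_of_def
  by (rule the_equality) (use assms three_cycle_eq_image in metis)+

section \<open>Conjugacy to the normal form and stability of the cycles of \<open>g\<close>\<close>

locale quadratic_map =
  fixes a b c \<beta> :: real and g :: "real \<Rightarrow> real"
  assumes a: "a \<noteq> 0" and g: "g = (\<lambda>x. a * x\<^sup>2 + b * x + c)"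
    and \<beta>: "\<beta>\<^sup>2 = b\<^sup>2 - 4 * a * c - 2 * b - 7"
begin

text \<open>Inverse of \<open>p \<mapsto> (- b + \<beta> + 1) / (2 * a) + p / a\<close>, the
  parametrisation of the cycle points with \<open>p\<close> the reciprocal of a root of
  \<open>Q_poly \<beta>\<close>.\<close>

definition coord :: "real \<Rightarrow> real" where "coord x = a * x + (b - 1 - \<beta>) / 2"

lemma coord_g: "coord (g x) = cycle_map \<beta> (coord x)"
proof -
  have "4 * (a * c) = b\<^sup>2 - 2 * b - 7 - \<beta>\<^sup>2" using \<beta> by simp
  then have "4 * coord (g x) = 4 * cycle_map \<beta> (coord x)"
    unfolding coord_def cycle_map_def g by (simp add: field_simps power2_eq_square)
  then show ?thesis by simp
qed

lemma coord_eq_iff: "coord x = coord y \<longleftrightarrow> x = y"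
  using a by (simp add: coord_def)

lemma coord_surj: "\<exists>x. coord x = p"
  using a by (intro exI[of _ "(p - (b - 1 - \<beta>) / 2) / a"]) (simp add: coord_def)

text \<open>Replaces the definite description and the sorted roots by one polynomial condition. The
  orbit of any zero is a 3-cycle, and its points are all the zeros.\<close>

lemma cycle_points_cycle_of: "cycle_points (cycle_of g a b \<beta>) = {x. cycle_poly \<beta> (coord x) = 0}"
proof -
  let ?k = "(- b + \<beta> + 1) / (2 * a)"
  let ?S = "{x. cycle_poly \<beta> (coord x) = 0}"
  obtain x where x: "cycle_poly \<beta> (coord x) = 0" using cycle_poly_has_root coord_surj by metis
  let ?C = "cyclic_class (x, g x, g (g x))"
  have S: "?S = {x, g x, g (g x)}"
    using cycle_poly_roots(1)[OF x] by (auto simp: coord_g[symmetric] coord_eq_iff set_eq_iff)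
  have ne: "g y \<noteq> y" if "cycle_poly \<beta> (coord y) = 0" for y
    using cycle_map_neq[OF that] by (metis coord_g)
  have "g (g (g x)) = x" using cycle_map_period_3[OF x] by (simp add: coord_g[symmetric] coord_eq_iff)
  moreover have "g x \<noteq> x" "g (g x) \<noteq> g x" using ne x S by blast+
  ultimately have "three_cycle_triple g (x, g x, g (g x))"
    unfolding three_cycle_triple_def by auto
  then have C: "?C \<in> three_cycles g" unfolding three_cycles_def by blast
  have pts: "cycle_points ?C = ?S" unfolding S by (auto simp: cycle_points_def cyclic_class_def)
  have "(\<lambda>i. ?k + 1 / (a * q_root \<beta> i)) ` {1, 2, 3} = (\<lambda>q. ?k + 1 / (a * q)) ` q_root \<beta> ` {1, 2, 3}"
    unfolding image_image ..
  also have "\<dots> = (\<lambda>p. ?k + p / a) ` {p. cycle_poly \<beta> p = 0}"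
    unfolding q_root_image Q_poly_roots image_image
    by (intro image_cong refl) (simp add: divide_simps)
  also have "\<dots> = ?S"
  proof (intro equalityI subsetI)
    fix y assume "y \<in> (\<lambda>p. ?k + p / a) ` {p. cycle_poly \<beta> p = 0}"
    then obtain p where p: "cycle_poly \<beta> p = 0" "y = ?k + p / a" by blast
    have "coord y = p" unfolding p(2) coord_def using a by (simp add: field_simps)
    then show "y \<in> ?S" using p by simp
  next
    fix y assume "y \<in> ?S"
    moreover have "y = ?k + coord y / a" unfolding coord_def using a by (simp add: field_simps)
    ultimately show "y \<in> (\<lambda>p. ?k + p / a) ` {p. cycle_poly \<beta> p = 0}" by blast
  qed
  finally have "cycle_of g a b \<beta> = ?C" using pts by (intro cycle_of_eqI C) simp
  then show ?thesis using pts by simp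
qed

lemma g3: "(g ^^ 3) x = g (g (g x))"
  by (simp add: numeral_3_eq_3)

definition slope :: "real \<Rightarrow> real" where "slope x = 2 * a * x + b"

lemma slope_eq: "slope x = 2 * coord x + 1 + \<beta>"
  by (simp add: slope_def coord_def field_simps)

context
  fixes x assumes x: "cycle_poly \<beta> (coord x) = 0"
begin

lemma g3_fixed: "(g ^^ 3) x = x"
  using cycle_map_period_3[OF x] by (simp add: g3 coord_g[symmetric] coord_eq_iff)

lemma slope_prod: "slope x * slope (g x) * slope (g (g x)) = 1 - 7 * \<beta> - \<beta>\<^sup>2 - \<beta> ^ 3"
  using cycle_multiplier[OF x] by (simp add: slope_eq coord_g)

lemma g3_deriv: "((g ^^ 3) has_real_derivative 1 - 7 * \<beta> - \<beta>\<^sup>2 - \<beta> ^ 3) (at x)"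
proof -
  have D: "(g has_real_derivative slope y) (at y)" for y
    unfolding g slope_def by (auto intro!: derivative_eq_intros)
  have "((\<lambda>x. g (g (g x))) has_real_derivative slope (g (g x)) * (slope (g x) * slope x)) (at x)"
    by (intro DERIV_chain2[OF D] DERIV_chain2[OF D] D)
  moreover have "g ^^ 3 = (\<lambda>x. g (g (g x)))" by (simp add: fun_eq_iff g3)
  ultimately show ?thesis using slope_prod by (simp add: mult_ac)
qed

lemma not_stable_saddle_node:
  assumes "\<beta> = 0"
  shows "\<not> stable_fixpoint (g ^^ 3) x"
\<comment> \<open>By \<open>drift\<close> below, \<open>a\<close> times the displacement is a square
  times a factor that is nonzero at \<open>x\<close>; multiplying by the value of that factor at
  \<open>x\<close> makes the sign positive nearby.\<close>
proof (rule unstable_if_one_sided_drift[where s = "a * (coord (g x) - coord x)"])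
  show "isCont (g ^^ 3) y" for y
  proof -
    have "g ^^ 3 = (\<lambda>x. g (g (g x)))" by (simp add: fun_eq_iff g3)
    then show ?thesis unfolding g by (simp add: continuous_intros)
  qed
  show "(g ^^ 3) x = x" by (rule g3_fixed)
  let ?s = "coord (g x) - coord x"
  have s: "?s \<noteq> 0" using cycle_map_neq[OF x] by (simp add: coord_g)
  have drift: "a * ((g ^^ 3) y - y) = (coord (g y) - coord y) * (cycle_poly \<beta> (coord y))\<^sup>2" for y
  proof -
    have "cycle_map \<beta> (cycle_map \<beta> (cycle_map \<beta> p)) - p = (cycle_map \<beta> p - p) * (cycle_poly \<beta> p)\<^sup>2" for p
      using cycle_map_iterate_saddle_node assms by simp
    moreover have "a * ((g ^^ 3) y - y) = coord ((g ^^ 3) y) - coord y" by (simp add: coord_def algebra_simps)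
    ultimately show ?thesis by (simp add: g3 coord_g)
  qed
  have cont: "isCont (\<lambda>y. ?s * (coord (g y) - coord y)) x"
    unfolding coord_def g by (intro continuous_intros)
  have "\<forall>\<^sub>F y in at x. ?s * (coord (g y) - coord y) > 0"
    using cont s by (intro order_tendstoD(1)[OF cont[unfolded isCont_def]]) (simp flip: power2_eq_square)
  \<comment> \<open>The square vanishes at the other cycle points too; being finitely many, they
    stay away from \<open>x\<close>.\<close>
  moreover have "\<forall>\<^sub>F y in at x. y \<notin> {y. cycle_poly \<beta> (coord y) = 0} - {x}"
  proof -
    have "finite (coord -` {p. cycle_poly \<beta> p = 0})"
      using cycle_poly_roots(1)[OF x] by (intro finite_vimageI) (auto simp: inj_on_def coord_eq_iff)
    then have "finite ({y. cycle_poly \<beta> (coord y) = 0} - {x})" by (simp add: vimage_def)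
    then have "open (- ({y. cycle_poly \<beta> (coord y) = 0} - {x}))" by (intro open_Compl finite_imp_closed)
    then show ?thesis unfolding eventually_at_topological by blast
  qed
  moreover have "\<forall>\<^sub>F y in at x. y \<noteq> x" by (rule eventually_neq_at_within)
  ultimately show "\<forall>\<^sub>F y in at x. a * ?s * ((g ^^ 3) y - y) > 0"
  proof eventually_elim
    case (elim y)
    have "a * ?s * ((g ^^ 3) y - y) = ?s * (a * ((g ^^ 3) y - y))" by (simp add: mult_ac)
    also have "\<dots> = ?s * (coord (g y) - coord y) * (cycle_poly \<beta> (coord y))\<^sup>2" unfolding drift by simp
    also have "\<dots> > 0" using elim by (intro mult_pos_pos[OF elim(1)]) auto
    finally show ?case .
  qed
qed

lemma stable_flip:
  assumes "1 - 7 * \<beta> - \<beta>\<^sup>2 - \<beta> ^ 3 = -1"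
  shows "stable_fixpoint (g ^^ 3) x \<and> attracting_fixpoint (g ^^ 3) x"
proof -
  define m0 m1 m2 where m: "m0 = slope x" "m1 = slope (g x)" "m2 = slope (g (g x))"
  have prod: "m0 * m1 * m2 = -1" using slope_prod assms m by simp
  \<comment> \<open>\<open>A\<close> and \<open>B\<close> are the coefficients of \<open>d^2\<close>
    and \<open>d^3\<close> in the expansion of the third iterate at \<open>x\<close>, a polynomial
    of degree 8; \<open>P\<close> collects the rest.\<close>
  define A where "A = a * (m2 * (m1 + m0\<^sup>2) + m0\<^sup>2 * m1\<^sup>2)"
  define B where "B = 2 * a\<^sup>2 * (m0 * m2 + m0 * m1 * (m1 + m0\<^sup>2))"
  define P where "P d = m2 * a ^ 3 + a * (a\<^sup>2 * (m1 + m0\<^sup>2)\<^sup>2 + 4 * a\<^sup>2 * m0\<^sup>2 * m1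
     + (2 * a ^ 3 * m0 * m1 + 4 * a ^ 3 * m0 * (m1 + m0\<^sup>2)) * d
     + (2 * a ^ 4 * (m1 + m0\<^sup>2) + 4 * a ^ 4 * m0\<^sup>2) * d\<^sup>2 + 4 * a ^ 5 * m0 * d ^ 3 + a ^ 6 * d ^ 4)" for d
  show ?thesis
  proof (rule asymptotically_stable_if_multiplier_minus_1)
    have shift: "g (y + e) = g y + (slope y * e + a * e\<^sup>2)" for y e
      by (simp add: g slope_def algebra_simps power2_eq_square)
    fix d
    \<comment> \<open>\<open>e1\<close> and \<open>e2\<close> are the displacements from the cycle
      after one and two steps.\<close>
    define e1 where "e1 = m0 * d + a * d\<^sup>2"
    define e2 where "e2 = m1 * e1 + a * e1\<^sup>2"
    have "(g ^^ 3) (x + d) = (g ^^ 3) x + (m2 * e2 + a * e2\<^sup>2)"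
      unfolding g3 shift m[symmetric] e1_def[symmetric] e2_def[symmetric] ..
    moreover have "m2 * e2 + a * e2\<^sup>2 = (m0 * m1 * m2) * d + A * d\<^sup>2 + B * d ^ 3 + P d * d ^ 4"
      unfolding e2_def e1_def A_def B_def P_def by algebra
    ultimately show "(g ^^ 3) (x + d) = x - d + A * d\<^sup>2 + B * d ^ 3 + P d * d ^ 4"
      unfolding g3_fixed prod by simp
  next
    show "isCont P 0" unfolding P_def by (intro continuous_intros)
  next
    \<comment> \<open>Because \<open>m0 m1 m2 = -1\<close>, the mixed products in the square \<open>A\<^sup>2\<close> add up to \<open>- B\<close>.\<close>
    have "A\<^sup>2 + B = a\<^sup>2 * ((m1 * m2)\<^sup>2 + (m2 * m0\<^sup>2)\<^sup>2 + (m0\<^sup>2 * m1\<^sup>2)\<^sup>2)"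
      using prod unfolding A_def B_def by algebra
    moreover have "m1 * m2 \<noteq> 0" using prod by auto
    ultimately show "A\<^sup>2 + B > 0"
      using a by (simp add: add_pos_nonneg)
  qed
qed

end

text \<open>Stability of a cycle asks for one stable point, so instability is shown at every
  point.\<close>

lemma unstable_cycle_if:
  assumes "\<bar>1 - 7 * \<beta> - \<beta>\<^sup>2 - \<beta> ^ 3\<bar> > 1 \<or> \<beta> = 0"
  shows "unstable_cycle g (cycle_of g a b \<beta>)"
proof -
  have "\<not> stable_fixpoint (g ^^ 3) x" if x: "cycle_poly \<beta> (coord x) = 0" for x
    using assms
  proof
    assume "\<bar>1 - 7 * \<beta> - \<beta>\<^sup>2 - \<beta> ^ 3\<bar> > 1"
    then show ?thesis by (rule unstable_if_multiplier_gt_1[OF g3_deriv[OF x] g3_fixed[OF x]])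
  qed (rule not_stable_saddle_node[OF x])
  then show ?thesis
    by (simp add: unstable_cycle_def stable_cycle_def cycle_points_cycle_of lyapunov_stable_point_iff)
qed

lemma asymptotically_stable_cycle_if:
  assumes "-1 \<le> 1 - 7 * \<beta> - \<beta>\<^sup>2 - \<beta> ^ 3" "1 - 7 * \<beta> - \<beta>\<^sup>2 - \<beta> ^ 3 < 1"
  shows "asymptotically_stable_cycle g (cycle_of g a b \<beta>)"
proof -
  obtain x where x: "cycle_poly \<beta> (coord x) = 0" using cycle_poly_has_root coord_surj by metis
  have "stable_fixpoint (g ^^ 3) x \<and> attracting_fixpoint (g ^^ 3) x"
  proof (cases "1 - 7 * \<beta> - \<beta>\<^sup>2 - \<beta> ^ 3 = -1")
    case False
    then have "\<bar>1 - 7 * \<beta> - \<beta>\<^sup>2 - \<beta> ^ 3\<bar> < 1" using assms by linarith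
    then show ?thesis by (rule asymptotically_stable_if_multiplier_lt_1[OF g3_deriv[OF x] g3_fixed[OF x]])
  qed (rule stable_flip[OF x])
  with g3_fixed[OF x] x show ?thesis
    by (auto simp: asymptotically_stable_cycle_def cycle_points_cycle_of lyapunov_stable_point_iff
      attracting_point_iff)
qed

end

theorem theorem2p6:
  fixes a b c \<delta> :: real and g :: "real \<Rightarrow> real"
  assumes "a \<noteq> 0"
    and "g = (\<lambda>x. a * x\<^sup>2 + b * x + c)"
    and "\<delta> = b\<^sup>2 - 4 * a * c - 2 * b - 7"
    and "\<delta> \<ge> 0"
  shows "(\<delta> \<in> {delta_nh<..} \<longrightarrow>
            unstable_cycle g (cycle_of g a b (sqrt \<delta>)) \<and>
            unstable_cycle g (cycle_of g a b (- sqrt \<delta>))) \<and>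
         (\<delta> \<in> {0<..delta_nh} \<longrightarrow>
            asymptotically_stable_cycle g (cycle_of g a b (sqrt \<delta>)) \<and>
            unstable_cycle g (cycle_of g a b (- sqrt \<delta>))) \<and>
         (\<delta> = 0 \<longrightarrow> unstable_cycle g (cycle_of g a b 0))"
proof -
  define r where "r = sqrt \<delta>"
  have r: "r \<ge> 0" "\<delta> = r\<^sup>2" using assms(4) by (auto simp: r_def)
  \<comment> \<open>The locale fixes only the square of \<beta>, so the two signs of the root yield
    the two cycles.\<close>
  interpret plus: quadratic_map a b c r g
    using assms r by unfold_locales auto
  interpret minus: quadratic_map a b c "- r" g
    using assms r by unfold_locales auto
  obtain s where s: "s > 0" "delta_nh = s\<^sup>2" "s ^ 3 + s\<^sup>2 + 7 * s = 2"
    by (rule delta_nh_root)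
  have minus_unstable: "unstable_cycle g (cycle_of g a b (- r))"
  proof (cases "r = 0")
    case False
    \<comment> \<open>This product is \<open>r * (r^2 - r + 7)\<close>, the excess over 1 of the
      multiplier at \<open>-r\<close>.\<close>
    then have "r * ((r - 1 / 2)\<^sup>2 + 27 / 4) > 0" using r by (intro mult_pos_pos add_nonneg_pos) auto
    then have "1 - 7 * (- r) - (- r)\<^sup>2 - (- r) ^ 3 > 1"
      by (simp add: field_simps power2_eq_square power3_eq_cube)
    then show ?thesis by (intro minus.unstable_cycle_if) linarith
  qed (use minus.unstable_cycle_if in simp)
  \<comment> \<open>The monotone expression is 1 minus the multiplier; it equals 2 at
    \<open>s\<close>, so comparing \<open>r\<close> with \<open>s\<close> compares the multiplier
    with -1.\<close>
  have mono: "x ^ 3 + x\<^sup>2 + 7 * x < y ^ 3 + y\<^sup>2 + 7 * y" if "0 \<le> x" "x < y" for x y :: real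
    using power_strict_mono[of x y 3] power_strict_mono[of x y 2] that by simp
  have "unstable_cycle g (cycle_of g a b r)" if "\<delta> > delta_nh"
  proof -
    have "s < r" using that s(2) r by (metis power_less_imp_less_base)
    then have "1 - 7 * r - r\<^sup>2 - r ^ 3 < -1" using mono[of s r] s by simp
    then show ?thesis by (intro plus.unstable_cycle_if) linarith
  qed
  moreover have "asymptotically_stable_cycle g (cycle_of g a b r)" if "0 < \<delta>" "\<delta> \<le> delta_nh"
  proof (rule plus.asymptotically_stable_cycle_if)
    have "r \<le> s" using that s r by (metis less_imp_le power2_le_imp_le)
    then show "-1 \<le> 1 - 7 * r - r\<^sup>2 - r ^ 3"
      using mono[of r s] s r by (cases "r = s") auto
    have "0 < r" using that r by (auto simp: less_le)
    then show "1 - 7 * r - r\<^sup>2 - r ^ 3 < 1" using mono[of 0 r] by simp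
  qed
  moreover have "unstable_cycle g (cycle_of g a b 0)" if "\<delta> = 0"
    using minus_unstable that r by simp
  ultimately show ?thesis using minus_unstable unfolding r_def[symmetric] by auto
qed

end
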